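(* For every integer $d\ge1$, the ML degree of the $d$-dimensional cross polytope $\mathrm{conv}(\pm e_1,\pm e_2,\dots,\pm e_d)\subset\mathbb{R}^d$ is $2^d$.
   Context: Here $e_1,\dots,e_d$ are the standard basis vectors. For a lattice polytope $P \subset \mathbb{R}^d$ with lattice points $P\cap\mathbb{Z}^d = \{a_1,\dots,a_n\}$ (for the cross polytope: $0,\pm e_1,\dots,\pm e_d$), the design matrix is $A = [a_1\ \cdots\ a_n] \in \mathbb{Z}^{d\times n}$, and $A'$ is $A$ with an additional first row of ones. The toric variety $V = V_A\subseteq \mathbb{C}^n$ (standard scaling) is the Zariski closure of the image of $\psi:(\mathbb{C}^* )^{d+1}\to(\mathbb{C}^* )^n$, $(s,\theta)\mapsto (s\theta^{a_1},\dots,s\theta^{a_n})$. For data $u\in\mathbb{N}^n$ with $u_+ = \sum_i u_i$, the score equations are $A'p = \frac{1}{u_+}A'u$ with $p\in V\cap(\mathbb{C}^* )^n$, and the ML degree of $P$ is the number of complex solutions $p$ for generic $u$. *)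

theory Defs
  imports "HOL-Analysis.Analysis" "HOL-Computational_Algebra.Polynomial"
begin

text \<open>
  For a finite set \<open>L\<close> of lattice points, the affine space of dimension \<open>n = card L\<close> is realised
  as \<open>L \<rightarrow>\<^sub>E UNIV\<close>, with one complex coordinate for each lattice point. No enumeration
  \<open>a_1, ..., a_n\<close> of \<open>L\<close> is chosen.
\<close>

abbreviation affine_space :: "'a set \<Rightarrow> ('a \<Rightarrow> complex) set" where
  "affine_space L \<equiv> L \<rightarrow>\<^sub>E UNIV"

inductive polyfun :: "'a set \<Rightarrow> (('a \<Rightarrow> complex) \<Rightarrow> complex) \<Rightarrow> bool" for L where
  const: "polyfun L (\<lambda>x. c)"
| coord: "a \<in> L \<Longrightarrow> polyfun L (\<lambda>x. x a)"
| add: "polyfun L f \<Longrightarrow> polyfun L g \<Longrightarrow> polyfun L (\<lambda>x. f x + g x)"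
| mult: "polyfun L f \<Longrightarrow> polyfun L g \<Longrightarrow> polyfun L (\<lambda>x. f x * g x)"

definition zariski_closure :: "'a set \<Rightarrow> ('a \<Rightarrow> complex) set \<Rightarrow> ('a \<Rightarrow> complex) set" where
  "zariski_closure L S =
     {x \<in> affine_space L. \<forall>f. polyfun L f \<longrightarrow> (\<forall>y\<in>S. f y = 0) \<longrightarrow> f x = 0}"

text \<open>
  \<open>Q\<close> holds for generic data \<open>u\<close> if it holds for all natural data in some nonempty Zariski open
  subset (equivalently, off the zero set of one nonzero polynomial).
\<close>

definition generically :: "'a set \<Rightarrow> (('a \<Rightarrow> nat) \<Rightarrow> bool) \<Rightarrow> bool" where
  "generically L Q \<longleftrightarrow>
     (\<exists>f. polyfun L f \<and> (\<exists>x\<in>affine_space L. f x \<noteq> 0) \<and>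
          (\<forall>u. f (\<lambda>a\<in>L. of_nat (u a)) \<noteq> 0 \<longrightarrow> Q u))"

definition lattice_points :: "(real ^ 'd) set \<Rightarrow> (int ^ 'd) set" where
  "lattice_points P = {a. (\<chi> i. real_of_int (a $ i)) \<in> P}"

definition monomial_map ::
  "(int ^ 'd) set \<Rightarrow> complex \<Rightarrow> complex ^ 'd \<Rightarrow> (int ^ 'd) \<Rightarrow> complex" where
  "monomial_map L s \<theta> = (\<lambda>a\<in>L. s * (\<Prod>i\<in>UNIV. (\<theta> $ i) powi (a $ i)))"

definition toric_variety :: "(int ^ 'd) set \<Rightarrow> ((int ^ 'd) \<Rightarrow> complex) set" where
  "toric_variety L =
     zariski_closure L {monomial_map L s \<theta> |s \<theta>. s \<noteq> 0 \<and> (\<forall>i. \<theta> $ i \<noteq> 0)}"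

text \<open>
  The design matrix with the additional row of ones: row \<open>None\<close> is the row of ones, row \<open>Some i\<close>
  is the \<open>i\<close>-th row of the design matrix, and the column indexed by \<open>a\<close> belongs to the lattice
  point \<open>a\<close>.
\<close>

fun design_matrix' :: "'d option \<Rightarrow> int ^ 'd \<Rightarrow> int" where
  "design_matrix' None a = 1"
| "design_matrix' (Some i) a = a $ i"

definition score_solutions ::
  "(int ^ 'd) set \<Rightarrow> ((int ^ 'd) \<Rightarrow> nat) \<Rightarrow> ((int ^ 'd) \<Rightarrow> complex) set" where
  "score_solutions L u =
     {p \<in> toric_variety L. (\<forall>a\<in>L. p a \<noteq> 0) \<and>
        (\<forall>r. (\<Sum>a\<in>L. of_int (design_matrix' r a) * p a) =
             1 / of_nat (\<Sum>a\<in>L. u a) * (\<Sum>a\<in>L. of_int (design_matrix' r a) * of_nat (u a)))}"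

text \<open>
  Meant for lattice polytopes \<open>P\<close>, which have finitely many lattice points; the number \<open>D\<close> is then
  unique, see \<open>has_ML_degree_unique\<close> below. Finiteness is required explicitly since \<open>card\<close> is \<open>0\<close>
  on infinite sets. The datum \<open>u = 0\<close>, where the score equations involve a division by zero, is
  harmless, as a generic condition may always exclude it.
\<close>

definition has_ML_degree :: "(real ^ 'd) set \<Rightarrow> nat \<Rightarrow> bool" where
  "has_ML_degree P D \<longleftrightarrow>
     generically (lattice_points P)
       (\<lambda>u. finite (score_solutions (lattice_points P) u) \<and>
            card (score_solutions (lattice_points P) u) = D)"

definition cross_polytope :: "(real ^ 'd) set" where
  "cross_polytope = convex hull (range (\<lambda>i. axis i 1) \<union> range (\<lambda>i. - axis i 1))"

lemma polyfun_restrict: "polyfun L f \<Longrightarrow> f (restrict x L) = f x"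
  by (induction rule: polyfun.induct) auto

lemma polyfun_line:
  assumes "polyfun L f"
  shows "\<exists>q. \<forall>t. poly q t = f (\<lambda>a. x a + t * v a)"
  using assms
proof (induction rule: polyfun.induct)
  case (const c)
  show ?case by (rule exI[of _ "[:c:]"]) simp
next
  case (coord a)
  show ?case by (rule exI[of _ "[:x a, v a:]"]) simp
next
  case (add f g)
  then obtain q r where "\<forall>t. poly q t = f (\<lambda>a. x a + t * v a)" "\<forall>t. poly r t = g (\<lambda>a. x a + t * v a)"
    by blast
  then show ?case by (intro exI[of _ "q + r"]) simp
next
  case (mult f g)
  then obtain q r where "\<forall>t. poly q t = f (\<lambda>a. x a + t * v a)" "\<forall>t. poly r t = g (\<lambda>a. x a + t * v a)"
    by blast
  then show ?case by (intro exI[of _ "q * r"]) simp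
qed

lemma polyfun_mult_nonzero:
  assumes f: "polyfun L f" "f x \<noteq> 0" and g: "polyfun L g" "g y \<noteq> 0"
  shows "\<exists>z. f z * g z \<noteq> 0"
proof -
  define l where "l = (\<lambda>t a. x a + t * (y a - x a))"
  obtain q r where q: "\<forall>t. poly q t = f (l t)" and r: "\<forall>t. poly r t = g (l t)"
    using polyfun_line[OF f(1), of x "\<lambda>a. y a - x a"] polyfun_line[OF g(1), of x "\<lambda>a. y a - x a"]
    unfolding l_def by blast
  have "l 0 = x" "l 1 = y" by (auto simp: l_def)
  then have "poly q 0 \<noteq> 0" "poly r 1 \<noteq> 0" using q r f g by auto
  then have "q * r \<noteq> 0" by auto
  then obtain t where "poly (q * r) t \<noteq> 0" using poly_all_0_iff_0 by blast
  then show ?thesis using q r by auto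
qed

lemma polyfun_nonzero_nat:
  assumes "finite L" "polyfun L f" "f x \<noteq> 0"
  shows "\<exists>u. f (\<lambda>a\<in>L. of_nat (u a)) \<noteq> 0"
proof -
  have "\<exists>y. f y \<noteq> 0 \<and> (\<forall>a\<in>L. y a \<in> \<nat>)"
    using assms(1)
  proof (induction rule: finite_induct)
    case empty
    then show ?case using assms(3) by auto
  next
    case (insert b M)
    then obtain y where y: "f y \<noteq> 0" "\<forall>a\<in>M. y a \<in> \<nat>" by blast
    define l where "l = (\<lambda>t a. y a + t * (if a = b then 1 else 0))"
    obtain q where q: "\<forall>t. poly q t = f (l t)"
      using polyfun_line[OF assms(2), of y "\<lambda>a. if a = b then 1 else 0"] unfolding l_def by blast
    have "l 0 = y" by (auto simp: l_def)
    then have "q \<noteq> 0" using q y(1) by auto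
    then have "finite ((\<lambda>t. t + y b) ` {t. poly q t = 0})" by (simp add: poly_roots_finite)
    moreover have "infinite (range (of_nat :: nat \<Rightarrow> complex))"
      by (simp add: finite_image_iff inj_of_nat)
    ultimately have "\<not> range of_nat \<subseteq> (\<lambda>t. t + y b) ` {t. poly q t = 0}"
      using finite_subset by blast
    then obtain n :: nat where n: "of_nat n \<notin> (\<lambda>t. t + y b) ` {t. poly q t = 0}"
      by blast
    have "poly q (of_nat n - y b) \<noteq> 0"
    proof
      assume "poly q (of_nat n - y b) = 0"
      then have "of_nat n \<in> (\<lambda>t. t + y b) ` {t. poly q t = 0}"
        by (intro image_eqI[where x = "of_nat n - y b"]) simp_all
      then show False using n by blast
    qed
    then have "f (l (of_nat n - y b)) \<noteq> 0" using q by simp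
    moreover have "\<forall>a\<in>insert b M. l (of_nat n - y b) a \<in> \<nat>"
      using y(2) by (auto simp: l_def)
    ultimately show ?case by blast
  qed
  then obtain y where y: "f y \<noteq> 0" "\<forall>a\<in>L. y a \<in> \<nat>" by blast
  then obtain u where "\<forall>a\<in>L. y a = of_nat (u a)" by (auto simp: Nats_def image_iff) metis
  then have "restrict y L = (\<lambda>a\<in>L. of_nat (u a))" by (intro restrict_ext) simp
  then show ?thesis using polyfun_restrict[OF assms(2), of y] y(1) by metis
qed

lemma has_ML_degree_unique:
  assumes "finite (lattice_points P)" "has_ML_degree P D" "has_ML_degree P D'"
  shows "D = D'"
proof -
  let ?L = "lattice_points P"
  obtain f x where f: "polyfun ?L f" "f x \<noteq> 0"
    "\<And>u. f (\<lambda>a\<in>?L. of_nat (u a)) \<noteq> 0 \<Longrightarrow> card (score_solutions ?L u) = D"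
    using assms(2) unfolding has_ML_degree_def generically_def by blast
  obtain g y where g: "polyfun ?L g" "g y \<noteq> 0"
    "\<And>u. g (\<lambda>a\<in>?L. of_nat (u a)) \<noteq> 0 \<Longrightarrow> card (score_solutions ?L u) = D'"
    using assms(3) unfolding has_ML_degree_def generically_def by blast
  obtain z where "f z * g z \<noteq> 0" using polyfun_mult_nonzero[of ?L f x g y] f(1,2) g(1,2) by metis
  then obtain u where "f (\<lambda>a\<in>?L. of_nat (u a)) * g (\<lambda>a\<in>?L. of_nat (u a)) \<noteq> 0"
    using polyfun_nonzero_nat[OF assms(1) polyfun.mult[OF f(1) g(1)]] by blast
  then show ?thesis using f(3) g(3) by auto
qed

end

theory Submission imports Defs
begin

text \<open>
  On the torus, the toric variety of the cross polytope is given by the binomials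
  \<open>p(e_i) * p(-e_i) = p(0)\<^sup>2\<close>, and the score equations say that all coordinates of \<open>p\<close> add up to \<open>1\<close>
  and that \<open>p(e_i) - p(-e_i) = b_i\<close>, the \<open>i\<close>-th coordinate of the sample mean. With \<open>s = p(0)\<close> and
  \<open>w_i = p(e_i) + p(-e_i)\<close>, one has to count the solutions of \<open>w_i\<^sup>2 = b_i\<^sup>2 + 4 s\<^sup>2\<close> and
  \<open>s + \<Sum> w_i = 1\<close>.

  The data are natural numbers, so the \<open>b_i\<close> are real. If the origin was observed at least once,
  then \<open>\<Sum> \<bar>b_i\<bar> < 1\<close>; if moreover no \<open>b_i\<close> is \<open>0\<close>, then all solutions turn out to be real and
  there are exactly \<open>2^d\<close> of them. This makes the genericity condition explicit, without
  a discriminant.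

  Lower bound (\<open>card_real_points_ge\<close>). For each of the \<open>2^d\<close> choices \<open>T\<close> of signs, the function
  \<open>s + \<Sum> (\<plusminus> sqrt (b_i\<^sup>2 + 4 s\<^sup>2))\<close> lies in \<open>(-1, 1)\<close> at \<open>s = 0\<close> and leaves \<open>[-1, 1]\<close> as
  \<open>s\<close> grows, because its asymptotic slope is an odd integer. So it takes the value \<open>1\<close> or \<open>-1\<close>
  at some \<open>s > 0\<close>. In the second case, changing the sign of \<open>s\<close> and of all square roots turns
  this into a solution with negative \<open>s\<close>.

  Upper bound (\<open>real_points_are_all\<close>). The product over all sign choices of
  \<open>1 - s - \<Sum> (\<plusminus> w_i)\<close> is a nonzero polynomial in \<open>s\<close> of degree at most \<open>2^d\<close>
  (\<open>norm_polyfun_le_is_poly\<close>), every solution gives a root of it, and a real root has at least the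
  multiplicity given by the number of real solutions above it (\<open>card_zero_factors_le_order\<close>). The
  \<open>2^d\<close> real solutions therefore account for all of its roots, which leaves no room for further
  real or complex solutions.
\<close>

section \<open>Norms of polynomials in square roots and their zeros\<close>

text \<open>
  Polynomial functions of total degree at most \<open>m\<close> in \<open>s\<close> and the coordinates \<open>w i\<close> with
  \<open>i \<in> I\<close>. The degree refers to some polynomial expression for the function; this is all that a
  degree bound for the norm requires.
\<close>

inductive polyfun_le :: "'i set \<Rightarrow> nat \<Rightarrow> (complex \<Rightarrow> ('i \<Rightarrow> complex) \<Rightarrow> complex) \<Rightarrow> bool" for I where
  const: "polyfun_le I m (\<lambda>s w. c)"
| var_s: "polyfun_le I (Suc m) (\<lambda>s w. s)"
| coord: "i \<in> I \<Longrightarrow> polyfun_le I (Suc m) (\<lambda>s w. w i)"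
| add: "polyfun_le I m f \<Longrightarrow> polyfun_le I m g \<Longrightarrow> polyfun_le I m (\<lambda>s w. f s w + g s w)"
| mult: "polyfun_le I m f \<Longrightarrow> polyfun_le I n g \<Longrightarrow> polyfun_le I (m + n) (\<lambda>s w. f s w * g s w)"

lemma polyfun_le_cong_coords:
  assumes "polyfun_le I m f" "\<And>i. i \<in> I \<Longrightarrow> w i = v i"
  shows "f s w = f s v"
  using assms by (induction rule: polyfun_le.induct) auto

lemma polyfun_le_scale: "polyfun_le I m f \<Longrightarrow> polyfun_le I m (\<lambda>s w. c * f s w)"
  using polyfun_le.mult[OF polyfun_le.const[of I 0 c]] by simp

lemma polyfun_le_sum:
  assumes "finite A" "\<And>i. i \<in> A \<Longrightarrow> polyfun_le I m (f i)"
  shows "polyfun_le I m (\<lambda>s w. \<Sum>i\<in>A. f i s w)"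
  using assms by (induction rule: finite_induct) (auto intro: polyfun_le.const polyfun_le.add)

lemma polyfun_le_empty_imp_poly:
  assumes "polyfun_le {} m f"
  shows "\<exists>p. degree p \<le> m \<and> (\<forall>s w. f s w = poly p s)"
  using assms
proof (induction rule: polyfun_le.induct)
  case (const m c)
  show ?case by (rule exI[of _ "[:c:]"]) simp
next
  case (var_s m)
  show ?case by (rule exI[of _ "[:0, 1:]"]) simp
next
  case (coord i m)
  then show ?case by simp
next
  case (add m f g)
  then obtain p q where "degree p \<le> m" "\<forall>s w. f s w = poly p s" "degree q \<le> m" "\<forall>s w. g s w = poly q s"
    by blast
  then show ?case by (intro exI[of _ "p + q"]) (simp add: degree_add_le)
next
  case (mult m f n g)
  then obtain p q where "degree p \<le> m" "\<forall>s w. f s w = poly p s" "degree q \<le> n" "\<forall>s w. g s w = poly q s"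
    by blast
  then show ?case
    by (intro exI[of _ "p * q"]) (auto intro: order_trans[OF degree_mult_le])
qed

text \<open>
  Modulo \<open>(w j)\<^sup>2 = c + 4 * s\<^sup>2\<close>, every polynomial is linear in \<open>w j\<close>, say \<open>g + w j * h\<close>. Here
  \<open>h\<close> has degree at most \<open>m - 1\<close>, which is expressed by bounding the degree of \<open>s * h\<close> by \<open>m\<close>:
  a product of two such functions \<open>h\<close> and \<open>h'\<close> only occurs as \<open>(c + 4 * s\<^sup>2) * h * h'\<close>, that is,
  as \<open>c * h * h' + 4 * (s * h) * (s * h')\<close>, so that the invariant is kept under multiplication
  without subtracting natural numbers.
\<close>

lemma polyfun_le_split_coord:
  assumes "polyfun_le (insert j I) m f"
  shows "\<exists>g h. polyfun_le I m g \<and> polyfun_le I m h \<and> polyfun_le I m (\<lambda>s w. s * h s w) \<and>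
           (\<forall>s w. (w j)\<^sup>2 = c + 4 * s\<^sup>2 \<longrightarrow> f s w = g s w + w j * h s w)"
  using assms
proof (induction rule: polyfun_le.induct)
  case (const m a)
  show ?case
    by (rule exI[of _ "\<lambda>s w. a"], rule exI[of _ "\<lambda>s w. 0"]) (simp add: polyfun_le.const)
next
  case (var_s m)
  show ?case
    by (rule exI[of _ "\<lambda>s w. s"], rule exI[of _ "\<lambda>s w. 0"]) (simp add: polyfun_le.const polyfun_le.var_s)
next
  case (coord i m)
  show ?case
  proof (cases "i = j")
    case True
    then show ?thesis
      by (intro exI[of _ "\<lambda>s w. 0"] exI[of _ "\<lambda>s w. 1"]) (simp add: polyfun_le.const polyfun_le.var_s)
  next
    case False
    then show ?thesis using coord
      by (intro exI[of _ "\<lambda>s w. w i"] exI[of _ "\<lambda>s w. 0"]) (simp add: polyfun_le.const polyfun_le.coord)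
  qed
next
  case (add m f f')
  then obtain g h g' h' where
    1: "polyfun_le I m g" "polyfun_le I m h" "polyfun_le I m (\<lambda>s w. s * h s w)"
      "\<forall>s w. (w j)\<^sup>2 = c + 4 * s\<^sup>2 \<longrightarrow> f s w = g s w + w j * h s w" and
    2: "polyfun_le I m g'" "polyfun_le I m h'" "polyfun_le I m (\<lambda>s w. s * h' s w)"
      "\<forall>s w. (w j)\<^sup>2 = c + 4 * s\<^sup>2 \<longrightarrow> f' s w = g' s w + w j * h' s w"
    by blast
  show ?case
  proof (intro exI conjI)
    show "polyfun_le I m (\<lambda>s w. g s w + g' s w)" "polyfun_le I m (\<lambda>s w. h s w + h' s w)"
      using 1 2 by (auto intro: polyfun_le.add)
    show "polyfun_le I m (\<lambda>s w. s * (h s w + h' s w))"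
      using polyfun_le.add[OF 1(3) 2(3)] by (simp add: algebra_simps)
    show "\<forall>s w. (w j)\<^sup>2 = c + 4 * s\<^sup>2 \<longrightarrow>
            f s w + f' s w = (g s w + g' s w) + w j * (h s w + h' s w)"
      using 1(4) 2(4) by (simp add: algebra_simps)
  qed
next
  case (mult m f n f')
  then obtain g h g' h' where
    1: "polyfun_le I m g" "polyfun_le I m h" "polyfun_le I m (\<lambda>s w. s * h s w)"
      "\<forall>s w. (w j)\<^sup>2 = c + 4 * s\<^sup>2 \<longrightarrow> f s w = g s w + w j * h s w" and
    2: "polyfun_le I n g'" "polyfun_le I n h'" "polyfun_le I n (\<lambda>s w. s * h' s w)"
      "\<forall>s w. (w j)\<^sup>2 = c + 4 * s\<^sup>2 \<longrightarrow> f' s w = g' s w + w j * h' s w"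
    by blast
  define G where "G = (\<lambda>s w. g s w * g' s w + (c * (h s w * h' s w) + 4 * ((s * h s w) * (s * h' s w))))"
  define H where "H = (\<lambda>s w. g s w * h' s w + h s w * g' s w)"
  show ?case
  proof (intro exI conjI)
    show "polyfun_le I (m + n) G" "polyfun_le I (m + n) H"
      unfolding G_def H_def using 1 2
      by (auto intro!: polyfun_le.add polyfun_le_scale intro: polyfun_le.mult)
    have "(\<lambda>s w. s * H s w) = (\<lambda>s w. g s w * (s * h' s w) + (s * h s w) * g' s w)"
      by (simp add: H_def algebra_simps)
    then show "polyfun_le I (m + n) (\<lambda>s w. s * H s w)"
      using polyfun_le.add[OF polyfun_le.mult[OF 1(1) 2(3)] polyfun_le.mult[OF 1(3) 2(1)]] by simp
    show "\<forall>s w. (w j)\<^sup>2 = c + 4 * s\<^sup>2 \<longrightarrow> f s w * f' s w = G s w + w j * H s w"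
    proof (intro allI impI)
      fix s :: complex and w :: "'a \<Rightarrow> complex"
      assume w: "(w j)\<^sup>2 = c + 4 * s\<^sup>2"
      have "f s w * f' s w = (g s w + w j * h s w) * (g' s w + w j * h' s w)"
        using 1(4) 2(4) w by simp
      also have "\<dots> = g s w * g' s w + (w j)\<^sup>2 * (h s w * h' s w) + w j * H s w"
        by (simp add: H_def algebra_simps power2_eq_square)
      also have "\<dots> = G s w + w j * H s w"
        unfolding w by (simp add: G_def algebra_simps power2_eq_square)
      finally show "f s w * f' s w = G s w + w j * H s w" .
    qed
  qed
qed

definition flip :: "'i set \<Rightarrow> ('i \<Rightarrow> 'a) \<Rightarrow> 'i \<Rightarrow> 'a::uminus" where
  "flip T w = (\<lambda>i. if i \<in> T then - w i else w i)"

text \<open>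
  The product of the conjugates of \<open>f\<close> under all sign changes of the square roots \<open>w i\<close> depends
  only on \<open>s\<close>. The roots are eliminated one at a time: multiplying \<open>g + w j * h\<close> by its conjugate
  gives \<open>g\<^sup>2 - (c j + 4 * s\<^sup>2) * h\<^sup>2\<close>, which is free of \<open>w j\<close> and of twice the degree, because
  \<open>s * h\<close> has no larger degree than \<open>g\<close>.
\<close>

lemma norm_polyfun_le_is_poly:
  assumes "finite I" "polyfun_le I m f"
  shows "\<exists>p. degree p \<le> m * 2 ^ card I \<and>
           (\<forall>s w. (\<forall>i\<in>I. (w i)\<^sup>2 = c i + 4 * s\<^sup>2) \<longrightarrow> (\<Prod>T\<in>Pow I. f s (flip T w)) = poly p s)"
  using assms
proof (induction I arbitrary: m f rule: finite_induct)
  case empty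
  then show ?case using polyfun_le_empty_imp_poly[of m f] by (simp add: flip_def)
next
  case (insert j I)
  obtain g h where gh: "polyfun_le I m g" "polyfun_le I m h" "polyfun_le I m (\<lambda>s w. s * h s w)"
    "\<And>s w. (w j)\<^sup>2 = c j + 4 * s\<^sup>2 \<Longrightarrow> f s w = g s w + w j * h s w"
    using polyfun_le_split_coord[OF insert.prems, of "c j"] by blast
  \<comment> \<open>\<open>N\<close> is the product of the two conjugates of \<open>f\<close> with respect to \<open>w j\<close>\<close>
  define N where "N = (\<lambda>s w. g s w * g s w + ((- c j) * (h s w * h s w) + (-4) * ((s * h s w) * (s * h s w))))"
  have "polyfun_le I (m + m) N"
    unfolding N_def by (intro polyfun_le.add polyfun_le_scale polyfun_le.mult gh)
  from insert.IH[OF this] obtain p where p: "degree p \<le> (m + m) * 2 ^ card I"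
    "\<And>s w. \<forall>i\<in>I. (w i)\<^sup>2 = c i + 4 * s\<^sup>2 \<Longrightarrow> (\<Prod>T\<in>Pow I. N s (flip T w)) = poly p s"
    by blast
  show ?case
  proof (intro exI conjI allI impI)
    show "degree p \<le> m * 2 ^ card (insert j I)" using p(1) insert.hyps by (simp add: algebra_simps)
    fix s w assume w: "\<forall>i\<in>insert j I. (w i)\<^sup>2 = c i + 4 * s\<^sup>2"
    have pair: "f s (flip T w) * f s (flip (insert j T) w) = N s (flip T w)" if "T \<in> Pow I" for T
    proof -
      let ?x = "flip T w" and ?y = "flip (insert j T) w"
      have j: "j \<notin> T" using that insert.hyps by auto
      have xy: "?x j = w j" "?y j = - w j" using j by (auto simp: flip_def)
      have wj: "(w j)\<^sup>2 = c j + 4 * s\<^sup>2" using w by blast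
      have "?y i = ?x i" if "i \<in> I" for i using that insert.hyps by (auto simp: flip_def)
      then have eq: "g s ?y = g s ?x" "h s ?y = h s ?x"
        by (auto intro: polyfun_le_cong_coords[OF gh(1)] polyfun_le_cong_coords[OF gh(2)])
      have "f s ?x * f s ?y = (g s ?x + w j * h s ?x) * (g s ?x - w j * h s ?x)"
        using gh(4)[of ?x s] gh(4)[of ?y s] by (simp add: xy wj eq)
      also have "\<dots> = g s ?x * g s ?x - (w j)\<^sup>2 * (h s ?x * h s ?x)"
        by (simp add: algebra_simps power2_eq_square)
      also have "\<dots> = N s ?x"
        unfolding wj by (simp add: N_def algebra_simps power2_eq_square)
      finally show ?thesis .
    qed
    have "(\<Prod>T\<in>Pow (insert j I). f s (flip T w)) =
        (\<Prod>T\<in>Pow I. f s (flip T w)) * (\<Prod>T\<in>insert j ` Pow I. f s (flip T w))"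
      unfolding Pow_insert using insert.hyps by (intro prod.union_disjoint) auto
    also have "(\<Prod>T\<in>insert j ` Pow I. f s (flip T w)) = (\<Prod>T\<in>Pow I. f s (flip (insert j T) w))"
      using insert.hyps by (subst prod.reindex) (auto simp: inj_on_def)
    also have "(\<Prod>T\<in>Pow I. f s (flip T w)) * \<dots> = (\<Prod>T\<in>Pow I. N s (flip T w))"
      by (simp add: prod.distrib[symmetric] pair)
    finally show "(\<Prod>T\<in>Pow (insert j I). f s (flip T w)) = poly p s"
      using p(2) w by simp
  qed
qed

text \<open>
  If more than \<open>m\<close> factors vanish at \<open>x\<close>, where \<open>m\<close> is the order of \<open>p\<close>, then dividing \<open>p\<close> by
  the \<open>m\<close>-th power of \<open>t - x\<close> leaves a function that tends to \<open>0\<close>, since each vanishing factor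
  has a finite difference quotient; but the cofactor of \<open>p\<close> does not vanish at \<open>x\<close>. Factors are
  counted rather than zeros of \<open>p\<close> because several of them can vanish at the same point.
\<close>

lemma card_zero_factors_le_order:
  fixes p :: "complex poly" and h :: "'i \<Rightarrow> real \<Rightarrow> real"
  assumes "finite A" "p \<noteq> 0" and p: "\<And>t. poly p (of_real t) = of_real (\<Prod>i\<in>A. h i t)"
    and diff: "\<And>i. i \<in> A \<Longrightarrow> h i differentiable at x"
  shows "card {i\<in>A. h i x = 0} \<le> order (of_real x) p"
proof (rule ccontr)
  define Z where "Z = {i\<in>A. h i x = 0}"
  define m where "m = order (of_real x) p"
  assume "\<not> card {i\<in>A. h i x = 0} \<le> order (of_real x) p"
  then have m: "m < card Z" by (simp add: Z_def m_def)
  obtain q where q: "p = [:- of_real x, 1:] ^ m * q" "\<not> [:- of_real x, 1:] dvd q"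
    using order_decomp[OF \<open>p \<noteq> 0\<close>] unfolding m_def by blast
  have qx: "poly q (of_real x) \<noteq> 0" using q(2) by (simp add: poly_eq_0_iff_dvd)
  obtain D where D: "\<And>i. i \<in> A \<Longrightarrow> (h i has_real_derivative D i) (at x)"
    using diff unfolding real_differentiable_def by metis
  have quot: "((\<lambda>t. h i t / (t - x)) \<longlongrightarrow> D i) (at x)" if "i \<in> Z" for i
    using D[of i] that unfolding has_field_derivative_iff by (simp add: Z_def)
  have cont: "(h i \<longlongrightarrow> h i x) (at x)" if "i \<in> A" for i
    using DERIV_isCont[OF D[OF that]] by (simp add: isCont_def)
  have fin: "finite Z" using assms(1) by (simp add: Z_def)
  define H where "H = (\<lambda>t. (t - x) ^ (card Z - m) * ((\<Prod>i\<in>Z. h i t / (t - x)) * (\<Prod>i\<in>A - Z. h i t)))"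
  have "(H \<longlongrightarrow> (x - x) ^ (card Z - m) * ((\<Prod>i\<in>Z. D i) * (\<Prod>i\<in>A - Z. h i x))) (at x)"
    unfolding H_def using quot cont by (intro tendsto_intros tendsto_prod) auto
  then have "((\<lambda>t. complex_of_real (H t)) \<longlongrightarrow> of_real 0) (at x)"
    using m by (intro tendsto_of_real) (simp add: power_0_left)
  moreover have "eventually (\<lambda>t. complex_of_real (H t) = poly q (of_real t)) (at x)"
  proof (rule eventually_mono[OF eventually_neq_at_within[of x]])
    fix t :: real assume t: "t \<noteq> x"
    let ?z = "of_real (t - x) :: complex" and ?P = "of_real ((\<Prod>i\<in>Z. h i t) * (\<Prod>i\<in>A - Z. h i t)) :: complex"
    have "?P = poly p (of_real t)"
      unfolding p using assms(1) by (subst mult.commute, subst prod.subset_diff[of Z A]) (auto simp: Z_def)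
    also have "\<dots> = ?z ^ m * poly q (of_real t)" unfolding q(1) by simp
    finally have *: "?P = ?z ^ m * poly q (of_real t)" .
    have "of_real (H t) = ?z ^ (card Z - m) * ?P / ?z ^ card Z"
      by (simp add: H_def prod_dividef)
    also have "\<dots> = (?z ^ (card Z - m) * ?z ^ m) * poly q (of_real t) / ?z ^ card Z"
      by (simp only: * mult.assoc)
    also have "?z ^ (card Z - m) * ?z ^ m = ?z ^ card Z"
      using m by (simp add: power_add[symmetric])
    finally show "complex_of_real (H t) = poly q (of_real t)"
      using t by simp
  qed
  ultimately have "((\<lambda>t. poly q (of_real t)) \<longlongrightarrow> 0) (at x)"
    by (simp add: tendsto_cong)
  moreover have "((\<lambda>t. poly q (of_real t)) \<longlongrightarrow> poly q (of_real x)) (at x)"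
    by (intro tendsto_intros)
  ultimately show False using qx tendsto_unique[of "at x"] by force
qed

section \<open>Counting the real solutions\<close>

text \<open>
  The left-hand side of \<open>s + (\<Sum>i. w i) = 1\<close> on one of the real branches of the curve
  \<open>(w i)\<^sup>2 = (b i)\<^sup>2 + 4 * s\<^sup>2\<close>; the coordinates in \<open>T\<close> carry the negative square root.
\<close>

definition branch :: "('i::finite \<Rightarrow> real) \<Rightarrow> 'i set \<Rightarrow> real \<Rightarrow> real" where
  "branch b T s = s + (\<Sum>i\<in>UNIV. flip T (\<lambda>i. sqrt ((b i)\<^sup>2 + 4 * s\<^sup>2)) i)"

lemma branch_Compl_minus: "branch b (- T) (- s) = - branch b T s"
proof -
  have "flip (- T) w i = - flip T w i" for w :: "'a \<Rightarrow> real" and i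
    by (simp add: flip_def)
  then show ?thesis by (simp add: branch_def sum_negf)
qed

lemma branch_differentiable:
  assumes "\<And>i. b i \<noteq> 0"
  shows "branch b T differentiable at s"
proof -
  have pos: "0 < (b i)\<^sup>2 + 4 * s\<^sup>2" for i
    using assms by (intro add_pos_nonneg) auto
  have "((\<lambda>s. sqrt ((b i)\<^sup>2 + 4 * s\<^sup>2)) has_real_derivative
      4 * s / sqrt ((b i)\<^sup>2 + 4 * s\<^sup>2)) (at s)" for i
    using pos[of i] by (auto intro!: derivative_eq_intros simp: field_simps)
  then have "(\<lambda>s. sqrt ((b i)\<^sup>2 + 4 * s\<^sup>2)) differentiable at s" for i
    unfolding real_differentiable_def by blast
  then have "(\<lambda>s. flip T (\<lambda>i. sqrt ((b i)\<^sup>2 + 4 * s\<^sup>2)) i) differentiable at s" for i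
    by (cases "i \<in> T") (auto simp: flip_def intro: derivative_intros)
  then show ?thesis
    unfolding branch_def by (intro derivative_intros) auto
qed

text \<open>
  The intermediate value theorem applies to \<open>\<bar>branch b T s\<bar>\<close> on \<open>[0, 3]\<close>. At \<open>0\<close> this is at most
  the sum of the \<open>\<bar>b i\<bar>\<close>. At a point \<open>s > 0\<close> the function \<open>branch b T\<close> differs by at most the same
  sum from \<open>(1 + 2 * k) * s\<close>, where \<open>k\<close> is the sum of the signs; the odd integer \<open>1 + 2 * k\<close> is not
  \<open>0\<close>, hence \<open>\<bar>branch b T 3\<bar>\<close> exceeds \<open>3 - 1\<close>.
\<close>

lemma branch_hits_pm_one:
  fixes b :: "'i::finite \<Rightarrow> real"
  assumes "(\<Sum>i\<in>UNIV. \<bar>b i\<bar>) < 1"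
  shows "\<exists>s>0. \<bar>branch b T s\<bar> = 1"
proof -
  let ?sg = "\<lambda>i. if i \<in> T then -1 else 1 :: int"
  define k where "k = (\<Sum>i\<in>UNIV. ?sg i)"
  have branch_sg: "branch b T s = s + (\<Sum>i\<in>UNIV. of_int (?sg i) * sqrt ((b i)\<^sup>2 + 4 * s\<^sup>2))" for s
    unfolding branch_def flip_def by (intro arg_cong2[of _ _ _ _ "(+)"] sum.cong) auto
  have at0: "\<bar>branch b T 0\<bar> < 1"
  proof -
    have "\<bar>branch b T 0\<bar> \<le> (\<Sum>i\<in>UNIV. \<bar>of_int (?sg i) * sqrt ((b i)\<^sup>2 + 4 * 0\<^sup>2)\<bar>)"
      unfolding branch_sg using sum_abs by simp
    also have "\<dots> = (\<Sum>i\<in>UNIV. \<bar>b i\<bar>)" by (intro sum.cong) auto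
    finally show ?thesis using assms by simp
  qed
  have at3: "1 < \<bar>branch b T 3\<bar>"
  proof -
    have "0 \<le> k \<or> k \<le> -1" by linarith
    then have "0 \<le> real_of_int k \<or> real_of_int k \<le> -1" by linarith
    then have main: "3 \<le> \<bar>3 + 6 * real_of_int k\<bar>" by linarith
    have "\<bar>branch b T 3 - (3 + 6 * of_int k)\<bar>
        = \<bar>\<Sum>i\<in>UNIV. of_int (?sg i) * (sqrt ((b i)\<^sup>2 + 4 * 3\<^sup>2) - 6)\<bar>"
      unfolding branch_sg k_def
      by (simp only: of_int_sum sum_distrib_left right_diff_distrib sum_subtractf) (simp add: mult.commute)
    also have "\<dots> \<le> (\<Sum>i\<in>UNIV. \<bar>of_int (?sg i) * (sqrt ((b i)\<^sup>2 + 4 * 3\<^sup>2) - 6)\<bar>)"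
      by (rule sum_abs)
    also have "\<dots> \<le> (\<Sum>i\<in>UNIV. \<bar>b i\<bar>)"
    proof (rule sum_mono)
      fix i
      have "6 \<le> sqrt ((b i)\<^sup>2 + 4 * 3\<^sup>2)" by (rule real_le_rsqrt) simp
      moreover have "sqrt ((b i)\<^sup>2 + 4 * 3\<^sup>2) \<le> \<bar>b i\<bar> + 6"
        by (rule real_le_lsqrt) (auto simp: power2_sum)
      ultimately show "\<bar>of_int (?sg i) * (sqrt ((b i)\<^sup>2 + 4 * 3\<^sup>2) - 6)\<bar> \<le> \<bar>b i\<bar>"
        by (simp add: abs_mult)
    qed
    finally show ?thesis using main assms by linarith
  qed
  have "\<exists>s\<ge>0. s \<le> 3 \<and> \<bar>branch b T s\<bar> = 1"
    using at0 at3 by (intro IVT') (auto simp: branch_sg intro!: continuous_intros)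
  then obtain s where "0 \<le> s" "\<bar>branch b T s\<bar> = 1" by blast
  moreover have "s \<noteq> 0" using at0 \<open>\<bar>branch b T s\<bar> = 1\<close> by auto
  ultimately show ?thesis by (intro exI[of _ s]) simp
qed

definition real_points :: "('i::finite \<Rightarrow> real) \<Rightarrow> (real \<times> 'i set) set" where
  "real_points b = {(s, T). branch b T s = 1}"

text \<open>
  There are as many branches as asserted solutions, but a branch may carry two of them or none, so
  one cannot pick one solution on each. Passing to \<open>- s\<close> and the complementary branch changes
  the sign of \<open>branch\<close>, so a point \<open>s > 0\<close> where \<open>branch b T\<close> is \<open>1\<close> or \<open>-1\<close> gives a solution on
  \<open>T\<close> or on \<open>- T\<close>. The sign of \<open>s\<close> tells which of the two cases occurred, hence different \<open>T\<close>
  give different solutions.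
\<close>

lemma card_real_points_ge:
  fixes b :: "'i::finite \<Rightarrow> real"
  assumes "(\<Sum>i\<in>UNIV. \<bar>b i\<bar>) < 1" "finite (real_points b)"
  shows "2 ^ CARD('i) \<le> card (real_points b)"
proof -
  obtain \<sigma> where \<sigma>: "\<And>T. \<sigma> T > 0" "\<And>T. \<bar>branch b T (\<sigma> T)\<bar> = 1"
    using branch_hits_pm_one[OF assms(1)] by metis
  define \<phi> where "\<phi> = (\<lambda>T. if branch b T (\<sigma> T) = 1 then (\<sigma> T, T) else (- \<sigma> T, - T))"
  have "\<phi> T \<in> real_points b" for T
    using \<sigma>(2)[of T] by (auto simp: \<phi>_def real_points_def branch_Compl_minus)
  moreover have "T = T'" if "\<phi> T = \<phi> T'" for T T'
    using that \<sigma>(1)[of T] \<sigma>(1)[of T'] by (auto simp: \<phi>_def split: if_splits)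
  ultimately have "card (UNIV :: 'i set set) \<le> card (real_points b)"
    by (intro card_inj_on_le[of \<phi>] assms(2)) (auto intro: injI)
  then show ?thesis using card_Pow[of "UNIV :: 'i set"] by simp
qed

section \<open>Absence of further complex solutions\<close>

lemma branch_norm_poly:
  fixes b :: "'i::finite \<Rightarrow> real"
  obtains p :: "complex poly" where "degree p \<le> 2 ^ CARD('i)"
    "\<And>s w. (\<And>i. (w i)\<^sup>2 = of_real ((b i)\<^sup>2) + 4 * s\<^sup>2) \<Longrightarrow>
        (\<Prod>T\<in>UNIV. 1 - (s + (\<Sum>i\<in>UNIV. flip T w i))) = poly p s"
    "\<And>s. poly p (of_real s) = of_real (\<Prod>T\<in>UNIV. 1 - branch b T s)"
proof -
  have "polyfun_le (UNIV :: 'i set) (Suc 0) (\<lambda>s w. 1 + (-1) * (s + (\<Sum>i\<in>UNIV. w i)))"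
    by (intro polyfun_le.add polyfun_le_scale polyfun_le_sum polyfun_le.const polyfun_le.var_s polyfun_le.coord) auto
  moreover have "(\<lambda>(s::complex) w. 1 + (-1) * (s + (\<Sum>i\<in>UNIV. w i))) = (\<lambda>s w. 1 - (s + (\<Sum>i\<in>(UNIV :: 'i set). w i)))"
    by (simp add: algebra_simps)
  ultimately have "polyfun_le (UNIV :: 'i set) (Suc 0) (\<lambda>s w. 1 - (s + (\<Sum>i\<in>UNIV. w i)))"
    by (simp only:)
  from norm_polyfun_le_is_poly[OF finite this, of "\<lambda>i. of_real ((b i)\<^sup>2)"]
  obtain p :: "complex poly" where p: "degree p \<le> 2 ^ CARD('i)"
    "\<And>s w. (\<And>i. (w i)\<^sup>2 = of_real ((b i)\<^sup>2) + 4 * s\<^sup>2) \<Longrightarrow>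
        (\<Prod>T\<in>UNIV. 1 - (s + (\<Sum>i\<in>UNIV. flip T w i))) = poly p s"
    unfolding Pow_UNIV One_nat_def[symmetric] mult_1 by blast
  have "poly p (of_real s) = of_real (\<Prod>T\<in>UNIV. 1 - branch b T s)" for s
  proof -
    let ?w = "\<lambda>i. complex_of_real (sqrt ((b i)\<^sup>2 + 4 * s\<^sup>2))"
    have "(?w i)\<^sup>2 = of_real ((b i)\<^sup>2) + 4 * (of_real s)\<^sup>2" for i
      by (simp flip: of_real_power)
    from p(2)[of ?w "of_real s", OF this, symmetric] show ?thesis
      by (simp add: branch_def flip_def if_distrib cong: if_cong)
  qed
  with p show ?thesis using that by blast
qed

text \<open>
  The score equations in the coordinates \<open>s = p 0\<close> and \<open>w i = p (axis i 1) + p (- axis i 1)\<close>,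
  where \<open>b i = p (axis i 1) - p (- axis i 1)\<close> is prescribed by the data.
\<close>

definition crit_points :: "('i::finite \<Rightarrow> real) \<Rightarrow> (complex \<times> ('i \<Rightarrow> complex)) set" where
  "crit_points b =
     {(s, w). (\<forall>i. (w i)\<^sup>2 = of_real ((b i)\<^sup>2) + 4 * s\<^sup>2) \<and> s + (\<Sum>i\<in>UNIV. w i) = 1}"

text \<open>
  The norm \<open>p\<close> of \<open>1 - (s + (\<Sum>i. w i))\<close> is a polynomial in \<open>s\<close> of degree at most \<open>2 ^ CARD('i)\<close>,
  and it is nonzero at \<open>0\<close>. The real solutions over a point contribute at most the order of \<open>p\<close>
  at this point, and there are at least \<open>2 ^ CARD('i)\<close> of them in total; thus they use up all roots
  of \<open>p\<close> with multiplicity. A solution with nonreal \<open>s\<close> would be one root too many. So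
  orders are compared at real points only, away from the branch points \<open>4 * s\<^sup>2 = - (b i)\<^sup>2\<close>.
\<close>

lemma real_points_are_all:
  fixes b :: "'i::finite \<Rightarrow> real"
  assumes b: "\<And>i. b i \<noteq> 0" "(\<Sum>i\<in>UNIV. \<bar>b i\<bar>) < 1"
  shows finite_real_points: "finite (real_points b)"
    and card_real_points: "card (real_points b) = 2 ^ CARD('i)"
    and crit_point_real: "(s, w) \<in> crit_points b \<Longrightarrow> s \<in> \<real>"
proof -
  obtain p :: "complex poly" where p: "degree p \<le> 2 ^ CARD('i)"
    "\<And>s w. (\<And>i. (w i)\<^sup>2 = of_real ((b i)\<^sup>2) + 4 * s\<^sup>2) \<Longrightarrow>
        (\<Prod>T\<in>UNIV. 1 - (s + (\<Sum>i\<in>UNIV. flip T w i))) = poly p s"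
    and p_real: "\<And>s. poly p (of_real s) = of_real (\<Prod>T\<in>UNIV. 1 - branch b T s)"
    using branch_norm_poly[of b] by blast
  have "p \<noteq> 0"
  proof -
    have "branch b T 0 \<noteq> 1" for T
    proof -
      have "branch b T 0 \<le> (\<Sum>i\<in>UNIV. \<bar>b i\<bar>)"
        unfolding branch_def by (auto simp: flip_def intro!: sum_mono)
      then show ?thesis using b(2) by simp
    qed
    then have "poly p (of_real 0) \<noteq> 0" unfolding p_real by simp
    then show ?thesis by auto
  qed
  have "real_points b \<subseteq> (of_real -` {z. poly p z = 0}) \<times> UNIV"
    by (auto simp: real_points_def p_real)
  moreover have "finite (of_real -` {z. poly p z = 0} :: real set)"
    using \<open>p \<noteq> 0\<close> by (intro finite_vimageI poly_roots_finite) (auto simp: inj_def)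
  ultimately show fin: "finite (real_points b)"
    by (meson finite_SigmaI finite finite_subset)
  \<comment> \<open>the real solutions, recorded by their first coordinate, as a submultiset of the roots of \<open>p\<close>\<close>
  define M where "M = image_mset (complex_of_real \<circ> fst) (mset_set (real_points b))"
  have count_M: "count M z = card {r \<in> real_points b. of_real (fst r) = z}" for z
    using fin by (auto simp: M_def count_image_mset vimage_def intro!: arg_cong[of _ _ card])
  have le: "count M z \<le> count (proots p) z" for z
  proof (cases "z \<in> \<real>")
    case True
    then obtain x where x: "z = of_real x" by (auto elim: Reals_cases)
    have "{r \<in> real_points b. of_real (fst r) = z} = Pair x ` {T. 1 - branch b T x = 0}"
      by (auto simp: real_points_def x)
    then have "count M z = card {T\<in>UNIV. 1 - branch b T x = 0}"
      by (simp add: count_M card_image inj_on_def)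
    also have "\<dots> \<le> order z p"
      unfolding x using \<open>p \<noteq> 0\<close> b(1)
      by (intro card_zero_factors_le_order p_real) (auto intro!: derivative_intros branch_differentiable)
    finally show ?thesis using \<open>p \<noteq> 0\<close> by simp
  next
    case False
    then have "{r \<in> real_points b. of_real (fst r) = z} = {}" by auto
    then have "count M z = 0" by (simp only: count_M card.empty)
    then show ?thesis by simp
  qed
  have size_M: "size M = card (real_points b)" by (simp add: M_def)
  have size_proots: "size (proots p) \<le> 2 ^ CARD('i)"
    using size_proots_le[of p] p(1) by simp
  have "M \<subseteq># proots p" using le by (simp add: subseteq_mset_def)
  then have "card (real_points b) \<le> 2 ^ CARD('i)"
    using size_mset_mono[of M "proots p"] size_M size_proots by simp
  then show card: "card (real_points b) = 2 ^ CARD('i)"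
    using card_real_points_ge[OF b(2) fin] by simp
  show "s \<in> \<real>" if sw: "(s, w) \<in> crit_points b"
  proof (rule ccontr)
    assume nonreal: "s \<notin> \<real>"
    have "1 - (s + (\<Sum>i\<in>UNIV. flip {} w i)) = 0"
      using sw by (simp add: crit_points_def flip_def)
    then have "(\<Prod>T\<in>UNIV. 1 - (s + (\<Sum>i\<in>UNIV. flip T w i))) = 0"
      by (intro prod_zero) auto
    moreover have "(w i)\<^sup>2 = of_real ((b i)\<^sup>2) + 4 * s\<^sup>2" for i
      using sw by (simp add: crit_points_def)
    ultimately have "poly p s = 0" using p(2)[of w s] by simp
    then have s: "1 \<le> order s p" using \<open>p \<noteq> 0\<close> order_root[of p s] by (simp add: Suc_le_eq)
    have "{r \<in> real_points b. of_real (fst r) = s} = {}" using nonreal by auto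
    then have "count M s = 0" by (simp only: count_M card.empty)
    then have "add_mset s M \<subseteq># proots p"
      using le s \<open>p \<noteq> 0\<close> by (auto simp: subseteq_mset_def)
    then have "size (add_mset s M) \<le> size (proots p)" by (rule size_mset_mono)
    then show False using size_M card size_proots by simp
  qed
qed

text \<open>
  Once \<open>s\<close> is known to be real, so is each \<open>w i\<close>, as its square is positive. As no \<open>b i\<close> is \<open>0\<close>,
  the two square roots differ, and \<open>T\<close> can be recovered from \<open>w\<close>.
\<close>

lemma bij_betw_real_points_crit_points:
  fixes b :: "'i::finite \<Rightarrow> real"
  assumes b: "\<And>i. b i \<noteq> 0" "(\<Sum>i\<in>UNIV. \<bar>b i\<bar>) < 1"
  shows "bij_betw (\<lambda>(s, T). (of_real s, flip T (\<lambda>i. of_real (sqrt ((b i)\<^sup>2 + 4 * s\<^sup>2)))))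
           (real_points b) (crit_points b)" (is "bij_betw ?F _ _")
proof -
  define r where "r = (\<lambda>s i. sqrt ((b i)\<^sup>2 + 4 * s\<^sup>2))"
  have r_pos: "0 < r s i" for s i
    unfolding r_def using b(1)[of i] by (intro real_sqrt_gt_zero add_pos_nonneg) auto
  have r_sq: "(r s i)\<^sup>2 = (b i)\<^sup>2 + 4 * s\<^sup>2" for s i by (simp add: r_def)
  have F: "?F (s, T) = (of_real s, \<lambda>i. of_real (flip T (r s) i))" for s T
    by (auto simp: r_def flip_def)
  show ?thesis
  proof (rule bij_betw_imageI)
    show "inj_on ?F (real_points b)"
    proof (rule inj_onI)
      fix x y assume eq: "?F x = ?F y"
      obtain s T s' T' where xy: "x = (s, T)" "y = (s', T')"
        by (cases x, cases y)
      from eq have s: "s = s'" and eq: "flip T (r s) i = flip T' (r s) i" for i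
        unfolding xy F by (auto dest: fun_cong)
      have "i \<in> T \<longleftrightarrow> i \<in> T'" for i
        using eq[of i] r_pos[of s i] by (auto simp: flip_def split: if_splits)
      then show "x = y" unfolding xy using s by blast
    qed
    show "?F ` real_points b = crit_points b"
    proof (intro equalityI subsetI)
      fix x assume "x \<in> ?F ` real_points b"
      then obtain s T where x: "x = ?F (s, T)" and R: "branch b T s = 1"
        by (auto simp: real_points_def)
      have "(complex_of_real (flip T (r s) i))\<^sup>2 = of_real ((b i)\<^sup>2) + 4 * (of_real s)\<^sup>2" for i
        using r_sq[of s i] by (simp add: flip_def flip: of_real_power)
      moreover have "complex_of_real s + (\<Sum>i\<in>UNIV. of_real (flip T (r s) i)) = of_real (branch b T s)"
        by (simp add: branch_def r_def)
      ultimately show "x \<in> crit_points b"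
        unfolding x F crit_points_def using R by simp
    next
      fix x assume x: "x \<in> crit_points b"
      obtain z w where zw: "x = (z, w)" by (cases x)
      obtain s where s: "z = of_real s"
        using crit_point_real[OF b, of z w] x zw Reals_cases by blast
      define T where "T = {i. w i \<noteq> of_real (r s i)}"
      have w: "w i = of_real (flip T (r s) i)" for i
      proof -
        have "(w i)\<^sup>2 = (of_real (r s i))\<^sup>2"
          using x r_sq[of s i] by (simp add: zw s crit_points_def flip: of_real_power)
        then show ?thesis by (auto simp: T_def flip_def power2_eq_iff)
      qed
      have "complex_of_real (branch b T s) = z + (\<Sum>i\<in>UNIV. w i)"
        by (simp add: branch_def w s r_def)
      also have "\<dots> = of_real 1" using x by (simp add: zw crit_points_def)
      finally have "branch b T s = 1" by (simp only: of_real_eq_iff)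
      then have "(s, T) \<in> real_points b" by (simp add: real_points_def)
      moreover have "x = ?F (s, T)" unfolding F zw s using w by auto
      ultimately show "x \<in> ?F ` real_points b" by blast
    qed
  qed
qed

section \<open>The lattice points of the cross polytope\<close>

lemma convex_l1_ball: "convex {x :: real ^ 'd. (\<Sum>i\<in>UNIV. \<bar>x $ i\<bar>) \<le> 1}"
proof (rule convexI, clarify)
  fix x y :: "real ^ 'd" and u v :: real
  assume x: "(\<Sum>i\<in>UNIV. \<bar>x $ i\<bar>) \<le> 1" and y: "(\<Sum>i\<in>UNIV. \<bar>y $ i\<bar>) \<le> 1"
    and uv: "0 \<le> u" "0 \<le> v" "u + v = 1"
  have "(\<Sum>i\<in>UNIV. \<bar>(u *\<^sub>R x + v *\<^sub>R y) $ i\<bar>) \<le> (\<Sum>i\<in>UNIV. u * \<bar>x $ i\<bar> + v * \<bar>y $ i\<bar>)"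
    using uv by (intro sum_mono order_trans[OF abs_triangle_ineq]) (auto simp: abs_mult intro: order_trans[OF abs_triangle_ineq])
  also have "\<dots> = u * (\<Sum>i\<in>UNIV. \<bar>x $ i\<bar>) + v * (\<Sum>i\<in>UNIV. \<bar>y $ i\<bar>)"
    by (simp add: sum.distrib sum_distrib_left)
  also have "\<dots> \<le> 1" using convex_bound_le[OF x y uv] by simp
  finally show "(\<Sum>i\<in>UNIV. \<bar>(u *\<^sub>R x + v *\<^sub>R y) $ i\<bar>) \<le> 1" .
qed

lemma int_vec_l1_le_1_cases:
  fixes a :: "int ^ 'd"
  assumes "(\<Sum>i\<in>UNIV. \<bar>a $ i\<bar>) \<le> 1"
  shows "a = 0 \<or> (\<exists>i. a = axis i 1 \<or> a = - axis i 1)"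
proof (cases "a = 0")
  case False
  then obtain i where i: "a $ i \<noteq> 0" by (auto simp: vec_eq_iff)
  have split: "\<bar>a $ i\<bar> + (\<Sum>j\<in>UNIV - {i}. \<bar>a $ j\<bar>) \<le> 1"
    using assms by (simp add: sum.remove[of UNIV i])
  moreover have "0 \<le> (\<Sum>j\<in>UNIV - {i}. \<bar>a $ j\<bar>)" by (intro sum_nonneg) auto
  ultimately have ai: "\<bar>a $ i\<bar> = 1" and "(\<Sum>j\<in>UNIV - {i}. \<bar>a $ j\<bar>) = 0"
    using i by linarith+
  then have "a $ j = 0" if "j \<noteq> i" for j
    using that by (simp add: sum_nonneg_eq_0_iff)
  then have "a = axis i (a $ i)" by (auto simp: vec_eq_iff axis_def)
  moreover have "axis i (-1) = - axis i (1::int)" by (auto simp: vec_eq_iff axis_def)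
  moreover have "a $ i = 1 \<or> a $ i = -1" using ai by linarith
  ultimately show ?thesis by metis
qed simp

definition cross_points :: "(int ^ 'd) set" where
  "cross_points = insert 0 (range (\<lambda>i. axis i 1) \<union> range (\<lambda>i. - axis i 1))"

lemma lattice_points_cross_polytope:
  "lattice_points (cross_polytope :: (real ^ 'd) set) = cross_points" (is "?L = ?R")
proof (intro equalityI subsetI)
  fix a assume a: "a \<in> ?L"
  have "cross_polytope \<subseteq> {x :: real ^ 'd. (\<Sum>i\<in>UNIV. \<bar>x $ i\<bar>) \<le> 1}"
    unfolding cross_polytope_def
    by (intro hull_minimal convex_l1_ball) (auto simp: axis_def if_distrib cong: if_cong)
  with a have "(\<Sum>i\<in>UNIV. \<bar>real_of_int (a $ i)\<bar>) \<le> 1"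
    by (auto simp: lattice_points_def)
  then have "real_of_int (\<Sum>i\<in>UNIV. \<bar>a $ i\<bar>) \<le> 1" by simp
  then have "(\<Sum>i\<in>UNIV. \<bar>a $ i\<bar>) \<le> 1" by (simp only: of_int_le_1_iff)
  from int_vec_l1_le_1_cases[OF this] show "a \<in> ?R"
    by (auto simp: cross_points_def)
next
  fix a assume "a \<in> ?R"
  then consider "a = 0" | i where "a = axis i 1" | i where "a = - axis i 1"
    by (auto simp: cross_points_def)
  then show "a \<in> ?L"
  proof cases
    case 1
    \<comment> \<open>the origin is the midpoint of two opposite vertices; some \<open>i\<close> exists since types are nonempty\<close>
    fix i :: 'd
    have "axis i 1 \<in> (cross_polytope :: (real ^ 'd) set)" "- axis i 1 \<in> (cross_polytope :: (real ^ 'd) set)"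
      unfolding cross_polytope_def by (auto intro: hull_inc)
    then have "(1/2) *\<^sub>R axis i 1 + (1/2) *\<^sub>R (- axis i 1) \<in> (cross_polytope :: (real ^ 'd) set)"
      unfolding cross_polytope_def by (intro convexD convex_convex_hull) auto
    then show ?thesis using 1 by (simp add: lattice_points_def vec_lambda_eta zero_vec_def)
  next
    case 2
    have "(\<chi> j. real_of_int (a $ j)) = axis i 1" using 2 by (auto simp: vec_eq_iff axis_def)
    then show ?thesis unfolding lattice_points_def cross_polytope_def by (auto intro: hull_inc)
  next
    case 3
    have "(\<chi> j. real_of_int (a $ j)) = - axis i 1" using 3 by (auto simp: vec_eq_iff axis_def)
    then show ?thesis unfolding lattice_points_def cross_polytope_def by (auto intro: hull_inc)
  qed
qed

lemma axis_1_neq_minus: "axis i 1 \<noteq> - axis j (1::int)" "- axis j (1::int) \<noteq> axis i 1"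
proof -
  have "axis i (1::int) $ i \<noteq> (- axis j 1) $ i" by (simp add: axis_def)
  then show "axis i 1 \<noteq> - axis j (1::int)" by metis
  then show "- axis j (1::int) \<noteq> axis i 1" by metis
qed

lemma axis_1_eq_iff: "axis i (1::int) = axis j 1 \<longleftrightarrow> i = j"
  by (auto simp: axis_eq_axis)

lemma sum_cross_points:
  fixes f :: "int ^ 'd \<Rightarrow> 'b::comm_monoid_add"
  shows "(\<Sum>a\<in>cross_points. f a) = f 0 + (\<Sum>i\<in>UNIV. f (axis i 1) + f (- axis i 1))"
proof -
  have "(\<Sum>a\<in>cross_points. f a) = f 0 + (\<Sum>a\<in>range (\<lambda>i. axis i 1) \<union> range (\<lambda>i. - axis i 1). f a)"
    unfolding cross_points_def by (intro sum.insert) (auto simp: axis_eq_0_iff)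
  also have "(\<Sum>a\<in>range (\<lambda>i. axis i 1) \<union> range (\<lambda>i. - axis i 1). f a) =
      (\<Sum>a\<in>range (\<lambda>i. axis i 1). f a) + (\<Sum>a\<in>range (\<lambda>i. - axis i 1). f a)"
    by (intro sum.union_disjoint) (auto simp: axis_1_neq_minus)
  also have "\<dots> = (\<Sum>i\<in>UNIV. f (axis i 1)) + (\<Sum>i\<in>UNIV. f (- axis i 1))"
    by (simp add: sum.reindex inj_on_def axis_1_eq_iff)
  finally show ?thesis by (simp add: sum.distrib)
qed

section \<open>The toric variety and its score equations\<close>

lemma subset_zariski_closure: "S \<subseteq> affine_space L \<Longrightarrow> S \<subseteq> zariski_closure L S"
  by (auto simp: zariski_closure_def)

lemma zariski_closureD:
  assumes "x \<in> zariski_closure L S" "polyfun L f" "\<And>y. y \<in> S \<Longrightarrow> f y = 0"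
  shows "f x = 0"
  using assms by (auto simp: zariski_closure_def)

text \<open>
  Inside the algebraic torus the image of the parametrization is already closed: from a point \<open>p\<close>
  that satisfies the quadratic binomials, the parameters are read off as \<open>s = p 0\<close> and
  \<open>\<theta> $ i = p (axis i 1) / p 0\<close>.
\<close>

lemma toric_points_cross:
  fixes p :: "int ^ 'd \<Rightarrow> complex"
  assumes "\<forall>a\<in>cross_points. p a \<noteq> 0"
  shows "p \<in> toric_variety cross_points \<longleftrightarrow>
    p \<in> affine_space cross_points \<and> (\<forall>i. p (axis i 1) * p (- axis i 1) = (p 0)\<^sup>2)"
proof
  have mem: "(0 :: int ^ 'd) \<in> cross_points" "axis i 1 \<in> cross_points" "- axis i 1 \<in> cross_points" for i :: 'd
    by (auto simp: cross_points_def)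
  have monom: "monomial_map cross_points s \<theta> 0 = s"
     "monomial_map cross_points s \<theta> (axis i 1) = s * \<theta> $ i"
     "monomial_map cross_points s \<theta> (- axis i 1) = s / \<theta> $ i" for s and \<theta> :: "complex ^ 'd" and i
  proof -
    have "(\<Prod>j\<in>UNIV. (\<theta> $ j) powi (axis i 1 $ j)) = (\<Prod>j\<in>UNIV. if j = i then \<theta> $ i else 1)"
      by (intro prod.cong) (auto simp: axis_def)
    moreover have "(\<Prod>j\<in>UNIV. (\<theta> $ j) powi ((- axis i 1) $ j)) = (\<Prod>j\<in>UNIV. if j = i then inverse (\<theta> $ i) else 1)"
      by (intro prod.cong) (auto simp: axis_def power_int_minus)
    ultimately show "monomial_map cross_points s \<theta> 0 = s"
     "monomial_map cross_points s \<theta> (axis i 1) = s * \<theta> $ i"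
     "monomial_map cross_points s \<theta> (- axis i 1) = s / \<theta> $ i"
      using mem by (simp_all add: monomial_map_def divide_inverse)
  qed
  let ?S = "{monomial_map cross_points s \<theta> |s \<theta>. s \<noteq> 0 \<and> (\<forall>i. (\<theta> :: complex ^ 'd) $ i \<noteq> 0)}"
  {
    assume p: "p \<in> toric_variety cross_points"
    have "p (axis i 1) * p (- axis i 1) = (p 0)\<^sup>2" for i
    proof -
      have binomial: "polyfun cross_points (\<lambda>x. x (axis i 1) * x (- axis i 1) + (-1) * (x 0 * x 0))"
        by (intro polyfun.add polyfun.mult polyfun.const polyfun.coord mem)
      have "p (axis i 1) * p (- axis i 1) + (-1) * (p 0 * p 0) = 0"
      proof (rule zariski_closureD[OF p[unfolded toric_variety_def] binomial])
        fix y assume "y \<in> ?S"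
        then show "y (axis i 1) * y (- axis i 1) + (-1) * (y 0 * y 0) = 0"
          by (auto simp: monom)
      qed
      then show ?thesis by (simp add: power2_eq_square)
    qed
    then show "p \<in> affine_space cross_points \<and> (\<forall>i. p (axis i 1) * p (- axis i 1) = (p 0)\<^sup>2)"
      using p by (simp add: toric_variety_def zariski_closure_def)
  }
  assume p: "p \<in> affine_space cross_points \<and> (\<forall>i. p (axis i 1) * p (- axis i 1) = (p 0)\<^sup>2)"
  define \<theta> :: "complex ^ 'd" where "\<theta> = (\<chi> i. p (axis i 1) / p 0)"
  have nz: "p 0 \<noteq> 0" "p (axis i 1) \<noteq> 0" for i using assms mem by auto
  have p_eq: "p = monomial_map cross_points (p 0) \<theta>"
  proof
    fix a show "p a = monomial_map cross_points (p 0) \<theta> a"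
    proof (cases "a \<in> cross_points")
      case True
      then consider "a = 0" | i where "a = axis i 1" | i where "a = - axis i 1"
        by (auto simp: cross_points_def)
      then show ?thesis
      proof cases
        case 3
        have "p (axis i 1) * p (- axis i 1) = p 0 * p 0" using p by (simp add: power2_eq_square)
        then show ?thesis using 3 nz by (simp add: monom \<theta>_def field_simps)
      qed (use nz in \<open>simp_all add: monom \<theta>_def\<close>)
    next
      case False
      then show ?thesis using p by (auto simp: monomial_map_def PiE_arb[of p cross_points])
    qed
  qed
  have "p 0 \<noteq> 0 \<and> (\<forall>i. \<theta> $ i \<noteq> 0)" using nz by (simp add: \<theta>_def)
  with p_eq have "p = monomial_map cross_points (p 0) \<theta> \<and> p 0 \<noteq> 0 \<and> (\<forall>i. \<theta> $ i \<noteq> 0)"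
    by (rule conjI)
  then have "p \<in> ?S" by (intro CollectI exI)
  have "?S \<subseteq> affine_space cross_points" by (auto simp: monomial_map_def)
  from subsetD[OF subset_zariski_closure[OF this] \<open>p \<in> ?S\<close>] show "p \<in> toric_variety cross_points"
    unfolding toric_variety_def .
qed

definition sample_mean :: "(int ^ 'd \<Rightarrow> nat) \<Rightarrow> 'd::finite \<Rightarrow> real" where
  "sample_mean u i = (real (u (axis i 1)) - real (u (- axis i 1))) / real (\<Sum>a\<in>cross_points. u a)"

lemma score_solutions_cross_iff:
  fixes p :: "int ^ 'd \<Rightarrow> complex"
  assumes "0 < u 0"
  shows "p \<in> score_solutions cross_points u \<longleftrightarrow>
    p \<in> affine_space cross_points \<and> (\<forall>a\<in>cross_points. p a \<noteq> 0) \<and>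
    (\<forall>i. p (axis i 1) * p (- axis i 1) = (p 0)\<^sup>2) \<and>
    p 0 + (\<Sum>i\<in>UNIV. p (axis i 1) + p (- axis i 1)) = 1 \<and>
    (\<forall>i. p (axis i 1) - p (- axis i 1) = of_real (sample_mean u i))"
proof -
  define U where "U = (\<Sum>a\<in>(cross_points :: (int ^ 'd) set). u a)"
  have "0 < U" unfolding U_def sum_cross_points using assms by simp
  have row_None: "(\<Sum>a\<in>cross_points. of_int (design_matrix' None a) * g a) =
      g 0 + (\<Sum>i\<in>UNIV. g (axis i 1) + g (- axis i 1))" for g :: "int ^ 'd \<Rightarrow> complex"
    by (simp add: sum_cross_points)
  have row_Some: "(\<Sum>a\<in>cross_points. of_int (design_matrix' (Some i) a) * g a) =
      g (axis i 1) - g (- axis i 1)" for g :: "int ^ 'd \<Rightarrow> complex" and i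
  proof -
    have "of_int (design_matrix' (Some i) (axis j 1)) * g (axis j 1)
        + of_int (design_matrix' (Some i) (- axis j 1)) * g (- axis j 1)
        = (if j = i then g (axis i 1) - g (- axis i 1) else 0)" for j
      by (cases "j = i") (auto simp: axis_def)
    then show ?thesis unfolding sum_cross_points by simp
  qed
  have U_None: "(\<Sum>a\<in>cross_points. of_int (design_matrix' None (a :: int ^ 'd)) * of_nat (u a)) = (of_nat U :: complex)"
    by (simp add: U_def)
  have mean: "1 / of_nat U * (of_nat (u (axis i 1)) - of_nat (u (- axis i 1))) = complex_of_real (sample_mean u i)" for i
    by (simp add: sample_mean_def U_def)
  have "(\<forall>r. (\<Sum>a\<in>cross_points. of_int (design_matrix' r a) * p a) =
           1 / of_nat U * (\<Sum>a\<in>cross_points. of_int (design_matrix' r a) * of_nat (u a))) \<longleftrightarrow>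
     p 0 + (\<Sum>i\<in>UNIV. p (axis i 1) + p (- axis i 1)) = 1 \<and>
    (\<forall>i. p (axis i 1) - p (- axis i 1) = of_real (sample_mean u i))"
    unfolding split_option_all U_None unfolding row_None row_Some mean
    using \<open>0 < U\<close> by simp
  then show ?thesis
    unfolding score_solutions_def U_def[symmetric] using toric_points_cross[of p] by auto
qed

text \<open>
  For a vertex \<open>a\<close>, the only nonzero summand is the one whose index \<open>i\<close> satisfies
  \<open>a = axis i 1\<close> or \<open>a = - axis i 1\<close>; the sum serves to read off \<open>i\<close> from \<open>a\<close>.
\<close>

definition crit_to_point :: "('d::finite \<Rightarrow> real) \<Rightarrow> complex \<times> ('d \<Rightarrow> complex) \<Rightarrow> int ^ 'd \<Rightarrow> complex" where
  "crit_to_point b = (\<lambda>(s, w). \<lambda>a\<in>cross_points.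
     if a = 0 then s else \<Sum>i\<in>UNIV. if a = axis i 1 then (w i + of_real (b i)) / 2
       else if a = - axis i 1 then (w i - of_real (b i)) / 2 else 0)"

lemma crit_to_point_simps:
  "crit_to_point b (s, w) 0 = s"
  "crit_to_point b (s, w) (axis i 1) = (w i + of_real (b i)) / 2"
  "crit_to_point b (s, w) (- axis i 1) = (w i - of_real (b i)) / 2"
  by (simp_all add: crit_to_point_def cross_points_def axis_1_eq_iff axis_1_neq_minus axis_eq_0_iff
      cong: if_cong)

text \<open>
  This keeps the solutions away from the coordinate hyperplanes: the coordinates
  \<open>p (axis i 1)\<close> and \<open>p (- axis i 1)\<close> have product \<open>s\<^sup>2\<close>. At \<open>s = 0\<close> one would have
  \<open>w i = b i\<close> or \<open>w i = - b i\<close>, and the \<open>w i\<close> could not add up to \<open>1\<close>.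
\<close>

lemma crit_point_nonzero:
  fixes b :: "'i::finite \<Rightarrow> real"
  assumes "(\<Sum>i\<in>UNIV. \<bar>b i\<bar>) < 1" "(s, w) \<in> crit_points b"
  shows "s \<noteq> 0"
proof
  assume "s = 0"
  then have w: "(w i)\<^sup>2 = (of_real (b i))\<^sup>2" "(\<Sum>i\<in>UNIV. w i) = 1" for i
    using assms(2) by (auto simp: crit_points_def)
  have "norm (w i) = \<bar>b i\<bar>" for i using w(1)[of i] by (auto simp: power2_eq_iff)
  then have "norm (\<Sum>i\<in>UNIV. w i) \<le> (\<Sum>i\<in>UNIV. \<bar>b i\<bar>)"
    by (intro order_trans[OF norm_sum]) simp
  then show False using w(2) assms(1) by simp
qed

text \<open>
  Sum and difference of \<open>p (axis i 1)\<close> and \<open>p (- axis i 1)\<close> determine both, and the binomial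
  \<open>p (axis i 1) * p (- axis i 1) = (p 0)\<^sup>2\<close> becomes \<open>(w i)\<^sup>2 = (b i)\<^sup>2 + 4 * s\<^sup>2\<close> because four times
  a product is the square of the sum minus the square of the difference.
\<close>

lemma bij_betw_crit_points_score_solutions:
  fixes u :: "int ^ 'd \<Rightarrow> nat"
  assumes "0 < u 0" and small: "(\<Sum>i\<in>UNIV. \<bar>sample_mean u i\<bar>) < 1"
  shows "bij_betw (crit_to_point (sample_mean u)) (crit_points (sample_mean u)) (score_solutions cross_points u)"
proof (rule bij_betw_imageI)
  let ?b = "sample_mean u" and ?F = "crit_to_point (sample_mean u)"
  show "inj_on ?F (crit_points ?b)"
  proof (rule inj_onI)
    fix x y assume eq: "?F x = ?F y"
    obtain s w s' w' where xy: "x = (s, w)" "y = (s', w')" by (cases x, cases y)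
    have "s = s'" using fun_cong[OF eq, of 0] by (simp add: xy crit_to_point_simps)
    moreover have "w i = w' i" for i
      using fun_cong[OF eq, of "axis i 1"] by (simp add: xy crit_to_point_simps)
    ultimately show "x = y" unfolding xy by auto
  qed
  show "?F ` crit_points ?b = score_solutions cross_points u"
  proof (intro equalityI subsetI)
    fix p assume "p \<in> ?F ` crit_points ?b"
    then obtain s w where p: "p = ?F (s, w)" and sw: "(s, w) \<in> crit_points ?b" by auto
    note simps = crit_to_point_simps[of ?b s w, folded p]
    have s: "s \<noteq> 0" using crit_point_nonzero[OF small sw] .
    have quad: "p (axis i 1) * p (- axis i 1) = (p 0)\<^sup>2" for i
    proof -
      have "p (axis i 1) * p (- axis i 1) = ((w i)\<^sup>2 - of_real ((?b i)\<^sup>2)) / 4"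
        by (simp add: simps power2_eq_square algebra_simps)
      also have "(w i)\<^sup>2 = of_real ((?b i)\<^sup>2) + 4 * s\<^sup>2" using sw by (simp add: crit_points_def)
      finally show ?thesis by (simp add: simps)
    qed
    have "p 0 \<noteq> 0" "p (axis i 1) \<noteq> 0" "p (- axis i 1) \<noteq> 0" for i
      using s quad[of i] simps(1) by auto
    then have "\<forall>a\<in>cross_points. p a \<noteq> 0" by (auto simp: cross_points_def)
    moreover have "p \<in> affine_space cross_points" by (auto simp: p crit_to_point_def)
    moreover have "p (axis i 1) + p (- axis i 1) = w i" "p (axis i 1) - p (- axis i 1) = of_real (?b i)" for i
      by (simp_all add: simps field_simps)
    moreover have "p 0 + (\<Sum>i\<in>UNIV. w i) = 1" using sw simps(1) by (simp add: crit_points_def)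
    ultimately show "p \<in> score_solutions cross_points u"
      unfolding score_solutions_cross_iff[of u, OF assms(1)] using quad by simp
  next
    fix p assume "p \<in> score_solutions cross_points u"
    note p = this[unfolded score_solutions_cross_iff[of u, OF assms(1)]]
    define w where "w = (\<lambda>i. p (axis i 1) + p (- axis i 1))"
    have diff: "p (axis i 1) - p (- axis i 1) = of_real (?b i)" for i using p by blast
    have quad: "p (axis i 1) * p (- axis i 1) = (p 0)\<^sup>2" for i using p by blast
    have "(w i)\<^sup>2 = of_real ((?b i)\<^sup>2) + 4 * (p 0)\<^sup>2" for i
      unfolding of_real_power w_def diff[of i, symmetric] quad[of i, symmetric]
      by (simp add: power2_eq_square algebra_simps)
    then have "(p 0, w) \<in> crit_points ?b" using p by (simp add: crit_points_def w_def)
    moreover have "p = ?F (p 0, w)"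
    proof
      fix a show "p a = ?F (p 0, w) a"
      proof (cases "a \<in> cross_points")
        case True
        then consider "a = 0" | i where "a = axis i 1" | i where "a = - axis i 1"
          by (auto simp: cross_points_def)
        then show ?thesis
          by cases (simp_all add: crit_to_point_simps w_def diff[symmetric])
      next
        case False
        then show ?thesis using p by (auto simp: crit_to_point_def PiE_arb[of p cross_points])
      qed
    qed
    ultimately show "p \<in> ?F ` crit_points ?b" by blast
  qed
qed

section \<open>The ML degree\<close>

text \<open>
  The sample mean is a convex combination of lattice points; positive weight at the origin places it
  in the interior of the cross polytope.
\<close>

lemma sum_abs_sample_mean_less_1:
  fixes u :: "int ^ 'd \<Rightarrow> nat"
  assumes "0 < u 0"
  shows "(\<Sum>i\<in>UNIV. \<bar>sample_mean u i\<bar>) < 1"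
proof -
  define U where "U = real (\<Sum>a\<in>(cross_points :: (int ^ 'd) set). u a)"
  have U: "U = real (u 0) + (\<Sum>i\<in>UNIV. real (u (axis i 1)) + real (u (- axis i 1)))"
    unfolding U_def sum_cross_points by simp
  have "0 \<le> (\<Sum>i\<in>UNIV. real (u (axis i 1)) + real (u (- axis i 1)))" by (intro sum_nonneg) auto
  then have "0 < U" unfolding U using assms by linarith
  have "(\<Sum>i\<in>UNIV. \<bar>sample_mean u i\<bar>) = (\<Sum>i\<in>UNIV. \<bar>real (u (axis i 1)) - real (u (- axis i 1))\<bar>) / U"
    unfolding sample_mean_def U_def[symmetric] using \<open>0 < U\<close> by (simp add: sum_divide_distrib)
  also have "\<dots> \<le> (\<Sum>i\<in>UNIV. real (u (axis i 1)) + real (u (- axis i 1))) / U"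
    using \<open>0 < U\<close> by (intro divide_right_mono sum_mono) auto
  also have "\<dots> < 1" using \<open>0 < U\<close> U assms by simp
  finally show ?thesis .
qed

lemma polyfun_prod:
  assumes "finite A" "\<And>i. i \<in> A \<Longrightarrow> polyfun L (f i)"
  shows "polyfun L (\<lambda>x. \<Prod>i\<in>A. f i x)"
  using assms by (induction rule: finite_induct) (auto intro: polyfun.intros)

theorem theorem5p13:
  "has_ML_degree (cross_polytope :: (real ^ 'd::finite) set) (2 ^ CARD('d))"
proof -
  let ?L = "cross_points :: (int ^ 'd) set"
  have mem: "0 \<in> ?L" "axis i 1 \<in> ?L" "- axis i 1 \<in> ?L" for i
    by (auto simp: cross_points_def)
  \<comment> \<open>\<open>f\<close> is nonzero at the data iff the origin was observed and no coordinate of the sample mean is \<open>0\<close>\<close>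
  define f where "f = (\<lambda>x :: int ^ 'd \<Rightarrow> complex. x 0 * (\<Prod>i\<in>UNIV. x (axis i 1) + (-1) * x (- axis i 1)))"
  have "polyfun ?L f"
    unfolding f_def
    by (intro polyfun.add polyfun.mult polyfun.const polyfun.coord polyfun_prod mem finite)
  moreover have "\<exists>x\<in>affine_space ?L. f x \<noteq> 0"
  proof
    \<comment> \<open>the values are \<open>1\<close> at \<open>0\<close>, \<open>2\<close> at \<open>axis i 1\<close> and \<open>0\<close> at \<open>- axis i 1\<close>\<close>
    let ?x = "\<lambda>a\<in>?L. of_int (1 + (\<Sum>i\<in>UNIV. a $ i)) :: complex"
    show "?x \<in> affine_space ?L" by simp
    have "(\<Sum>j\<in>UNIV. complex_of_int (axis i 1 $ j)) = 1" for i :: 'd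
      by (simp add: axis_def flip: of_int_sum)
    then show "f ?x \<noteq> 0" using mem by (simp add: f_def sum_negf)
  qed
  moreover have "finite (score_solutions ?L u) \<and> card (score_solutions ?L u) = 2 ^ CARD('d)"
    if "f (\<lambda>a\<in>?L. of_nat (u a)) \<noteq> 0" for u
  proof -
    have u: "0 < u 0" "u (axis i 1) \<noteq> u (- axis i 1)" for i
      using that mem by (auto simp: f_def)
    have small: "(\<Sum>i\<in>UNIV. \<bar>sample_mean u i\<bar>) < 1" using sum_abs_sample_mean_less_1 u(1) by blast
    have "0 < (\<Sum>a\<in>?L. u a)" unfolding sum_cross_points using u(1) by simp
    then have "0 < real (\<Sum>a\<in>?L. u a)" by (simp only: of_nat_0_less_iff)
    then have "real (\<Sum>a\<in>?L. u a) \<noteq> 0" by (rule less_imp_neq[THEN not_sym])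
    moreover have "real (u (axis i 1)) - real (u (- axis i 1)) \<noteq> 0" for i
      using u(2)[of i] by simp
    ultimately have nz: "sample_mean u i \<noteq> 0" for i
      unfolding sample_mean_def divide_eq_0_iff by blast
    note bij = bij_betw_trans[OF bij_betw_real_points_crit_points[OF nz small]
        bij_betw_crit_points_score_solutions[OF u(1) small]]
    show ?thesis
      using bij_betw_finite[OF bij] bij_betw_same_card[OF bij]
        finite_real_points[OF nz small] card_real_points[OF nz small] by simp
  qed
  ultimately show ?thesis
    unfolding has_ML_degree_def generically_def lattice_points_cross_polytope by blast
qed

end
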